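(* Let $p \geq 4$ be an even integer and let $D$ be an oriented graph with at least $p + 2$ vertices. Then $\mathrm{inv}^{= p}(D) \leq (2p-2)(\mathrm{fas}(D) + 1)$.
   Context: For an oriented graph $D$ and $X\subseteq V(D)$, the inversion of $X$ reverses the orientation of every arc with both endpoints in $X$. A $(=p)$-inversion is the inversion of a set of exactly $p$ vertices. $\mathrm{inv}^{=p}(D)$ is the minimum number of $(=p)$-inversions whose successive application makes $D$ acyclic ($+\infty$ if impossible). $\mathrm{fas}(D)$ is the minimum size of a set of arcs whose deletion makes $D$ acyclic. *)

theory Defs
  imports "Graph_Theory.Graph_Theory" "HOL-Library.Extended_Nat"
begin

locale oriented_graph = pair_digraph +
  assumes no_digon: "(u, v) \<in> parcs G \<Longrightarrow> (v, u) \<notin> parcs G"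

text \<open>In the arc \<open>(u, v)\<close>, \<open>u\<close> is the tail and \<open>v\<close> the head.\<close>

definition inversion :: "'a set \<Rightarrow> 'a pair_pre_digraph \<Rightarrow> 'a pair_pre_digraph" where
  "inversion X D = D \<lparr> parcs :=
     (\<lambda>(u, v). if u \<in> X \<and> v \<in> X then (v, u) else (u, v)) ` parcs D \<rparr>"

definition acyclic_digraph :: "'a pair_pre_digraph \<Rightarrow> bool" where
  "acyclic_digraph D \<longleftrightarrow> (\<nexists>c. pre_digraph.cycle (with_proj D) c)"

definition delete_arcs :: "('a \<times> 'a) set \<Rightarrow> 'a pair_pre_digraph \<Rightarrow> 'a pair_pre_digraph" where
  "delete_arcs F D = D \<lparr> parcs := parcs D - F \<rparr>"

text \<open>The infimum over the empty set is \<open>\<infinity>\<close>, the value prescribed when no sequence of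
  inversions makes \<open>D\<close> acyclic.\<close>

definition inv_eq :: "nat \<Rightarrow> 'a pair_pre_digraph \<Rightarrow> enat" where
  "inv_eq p D = Inf {enat (length Xs) | Xs.
     (\<forall>X \<in> set Xs. X \<subseteq> pverts D \<and> card X = p) \<and> acyclic_digraph (fold inversion Xs D)}"

text \<open>For finite \<open>D\<close> this is a genuine minimum of a nonempty set: \<open>F = parcs D\<close> qualifies.\<close>

definition fas :: "'a pair_pre_digraph \<Rightarrow> nat" where
  "fas D = Inf {card F | F. F \<subseteq> parcs D \<and> acyclic_digraph (delete_arcs F D)}"

end

theory Submission
  imports Defs
begin

text \<open>
  Inversions commute, and a sequence of them reverses exactly the arcs whose endpoints lie
  together in an odd number of the inverted sets. For \<open>|A| = p - 1\<close>, inverting \<open>A \<union> {a}\<close> and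
  \<open>A \<union> {b}\<close> reverses the complete bipartite graph between \<open>{a, b}\<close> and \<open>A\<close>. Two such steps, with
  sets \<open>A\<close> that differ in one element, reverse a 4-cycle; this is where \<open>p + 2\<close> vertices are
  needed. As \<open>p - 1\<close> is odd, \<open>(p - 2) / 2\<close> of these 4-cycles reduce the bipartite graph to a path
  with two edges, at a total cost of \<open>2 + 4 (p - 2) / 2 = 2p - 2\<close>. Hence any two edges can be
  reversed at cost \<open>2 (2p - 2)\<close>, through an edge joining them if they are disjoint.
  It remains to find an ordering of the vertices with an even number of backward arcs, at most
  \<open>fas D + 1\<close>. If an optimal ordering has an odd number of them, move one endpoint of a shortest
  arc just past the other: this changes the direction of that arc only.
\<close>

section \<open>Edge sets reversed by inversions\<close>

text \<open>Recording unordered pairs by parity turns concatenation of sequences into symmetric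
  difference. Singletons and the empty set may belong too, as may larger sets; only two-element sets
  matter for arcs.\<close>

definition odd_pairs :: "'a set list \<Rightarrow> 'a set set" where
  "odd_pairs Xs = {e. odd (length (filter (\<lambda>X. e \<subseteq> X) Xs))}"

lemma odd_pairs_append: "odd_pairs (Xs @ Ys) = sym_diff (odd_pairs Xs) (odd_pairs Ys)"
  by (auto simp: odd_pairs_def)

text \<open>An inversion keeps the unordered pair underlying each arc, so later inversions test the
  same pair and only the parity of the number of hits counts.\<close>

lemma parcs_fold_inversion:
  "parcs (fold inversion Xs D) =
     (\<lambda>(u, v). if {u, v} \<in> odd_pairs Xs then (v, u) else (u, v)) ` parcs D"
proof (induction Xs arbitrary: D)
  case Nil
  then show ?case by (auto simp: odd_pairs_def)
next
  case (Cons X Xs)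
  let ?flip = "\<lambda>S (u, v). if {u, v} \<in> S then (v, u) else (u, v)"
  have flip: "?flip (odd_pairs Xs) ((\<lambda>(u, v). if u \<in> X \<and> v \<in> X then (v, u) else (u, v)) a) =
      ?flip (odd_pairs (X # Xs)) a" for a
    by (cases a) (simp add: odd_pairs_def insert_commute)
  have "parcs (inversion X D) = (\<lambda>(u, v). if u \<in> X \<and> v \<in> X then (v, u) else (u, v)) ` parcs D"
    by (simp add: inversion_def)
  then show ?case
    unfolding fold_simps comp_def Cons.IH by (simp only: image_image flip)
qed

lemma pverts_fold_inversion [simp]: "pverts (fold inversion Xs D) = pverts D"
  by (induction Xs arbitrary: D) (auto simp: inversion_def)

text \<open>The restriction to \<open>card e = 2\<close> discards the irrelevant members of
  \<open>odd_pairs\<close>. The bound \<open>n\<close> is only an upper bound, so costs add and may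
  be weakened.\<close>

definition reversible :: "nat \<Rightarrow> 'a set \<Rightarrow> nat \<Rightarrow> 'a set set \<Rightarrow> bool" where
  "reversible p V n E \<longleftrightarrow> (\<exists>Xs. (\<forall>X \<in> set Xs. X \<subseteq> V \<and> card X = p) \<and> length Xs \<le> n \<and>
     (\<forall>e. card e = 2 \<longrightarrow> (e \<in> odd_pairs Xs \<longleftrightarrow> e \<in> E)))"

lemma reversible_empty: "reversible p V 0 {}"
  unfolding reversible_def by (rule exI[of _ "[]"]) (simp add: odd_pairs_def)

lemma reversible_mono: "reversible p V n E \<Longrightarrow> n \<le> m \<Longrightarrow> reversible p V m E"
  unfolding reversible_def by (meson le_trans)

lemma reversible_sym_diff:
  assumes "reversible p V n E" and "reversible p V m F"
  shows "reversible p V (n + m) (sym_diff E F)"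
proof -
  obtain Xs where Xs: "\<forall>X \<in> set Xs. X \<subseteq> V \<and> card X = p" "length Xs \<le> n"
    "\<forall>e. card e = 2 \<longrightarrow> (e \<in> odd_pairs Xs \<longleftrightarrow> e \<in> E)"
    using assms(1) unfolding reversible_def by auto
  obtain Ys where Ys: "\<forall>X \<in> set Ys. X \<subseteq> V \<and> card X = p" "length Ys \<le> m"
    "\<forall>e. card e = 2 \<longrightarrow> (e \<in> odd_pairs Ys \<longleftrightarrow> e \<in> F)"
    using assms(2) unfolding reversible_def by auto
  show ?thesis
    unfolding reversible_def using Xs Ys
    by (intro exI[of _ "Xs @ Ys"]) (auto simp: odd_pairs_append)
qed

section \<open>Bipartite graphs with two centres, four-cycles and two-edge paths\<close>

definition two_star :: "'a \<Rightarrow> 'a \<Rightarrow> 'a set \<Rightarrow> 'a set set" where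
  "two_star a b A = {{x, z} | x z. x \<in> {a, b} \<and> z \<in> A}"

text \<open>As neither centre lies in \<open>A\<close> or \<open>B\<close>, an edge determines its
  non-central endpoint, so edges cancel exactly when these endpoints do.\<close>

lemma two_star_sym_diff:
  assumes "a \<notin> A \<union> B" and "b \<notin> A \<union> B"
  shows "sym_diff (two_star a b A) (two_star a b B) = two_star a b (sym_diff A B)"
proof -
  have *: "{x, z} \<in> two_star a b C \<longleftrightarrow> z \<in> C"
    if "x \<in> {a, b}" "z \<in> A \<union> B" "C \<subseteq> A \<union> B" for x z C
    using that assms by (auto simp: two_star_def doubleton_eq_iff)
  show ?thesis
  proof (intro set_eqI iffI)
    fix e assume e: "e \<in> sym_diff (two_star a b A) (two_star a b B)"
    then obtain x z where xz: "e = {x, z}" "x \<in> {a, b}" "z \<in> A \<union> B"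
      by (auto simp: two_star_def)
    then show "e \<in> two_star a b (sym_diff A B)"
      using e *[of x z A] *[of x z B] *[of x z "sym_diff A B"] by auto
  next
    fix e assume e: "e \<in> two_star a b (sym_diff A B)"
    then obtain x z where xz: "e = {x, z}" "x \<in> {a, b}" "z \<in> sym_diff A B"
      unfolding two_star_def by blast
    then show "e \<in> sym_diff (two_star a b A) (two_star a b B)"
      using *[of x z A] *[of x z B] by auto
  qed
qed

text \<open>Pairs inside \<open>A\<close> lie in both inverted sets and cancel, while the pair of
  \<open>a\<close> and \<open>b\<close> lies in neither. What remains joins a centre to
  \<open>A\<close>.\<close>

lemma reversible_two_star:
  assumes "finite V" and "insert a (insert b A) \<subseteq> V" and "a \<noteq> b" and "a \<notin> A" and "b \<notin> A"
    and "Suc (card A) = p"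
  shows "reversible p V 2 (two_star a b A)"
proof -
  have "A \<subseteq> V" using assms(2) by simp
  then have "finite A" using assms(1) by (rule finite_subset)
  moreover have "e \<in> odd_pairs [insert a A, insert b A] \<longleftrightarrow> e \<in> two_star a b A"
    if card_e: "card e = 2" for e
  proof -
    obtain u v where uv: "e = {u, v}" "u \<noteq> v"
      using card_e by (auto simp: card_2_iff)
    have "e \<in> two_star a b A \<longleftrightarrow> (u \<in> {a, b} \<and> v \<in> A) \<or> (v \<in> {a, b} \<and> u \<in> A)"
      unfolding two_star_def uv(1) mem_Collect_eq doubleton_eq_iff by blast
    moreover have "e \<in> odd_pairs [insert a A, insert b A] \<longleftrightarrow>
        (e \<subseteq> insert a A) \<noteq> (e \<subseteq> insert b A)"
      by (simp add: odd_pairs_def)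
    ultimately show ?thesis
      unfolding uv(1) using assms(3-5) uv(2) by simp blast
  qed
  ultimately show ?thesis
    unfolding reversible_def using assms
    by (intro exI[of _ "[insert a A, insert b A]"]) auto
qed

text \<open>The set \<open>Z\<close> pads \<open>c\<close> and \<open>d\<close> to size
  \<open>p - 1\<close>, and its edges to the centres cancel. It must avoid all four vertices and
  have \<open>p - 2\<close> elements.\<close>

lemma reversible_four_cycle:
  assumes "finite V" and "p + 2 \<le> card V" and "2 \<le> p" and "{a, b, c, d} \<subseteq> V"
    and "distinct [a, b, c, d]"
  shows "reversible p V 4 (two_star a b {c, d})"
proof -
  have "card (V - {a, b, c, d}) = card V - 4"
    using assms by (subst card_Diff_subset) auto
  then have "p - 2 \<le> card (V - {a, b, c, d})"
    using assms by simp
  then obtain Z where Z: "Z \<subseteq> V - {a, b, c, d}" "card Z = p - 2" "finite Z"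
    by (meson obtain_subset_with_card_n)
  have "reversible p V 2 (two_star a b (insert c Z))" "reversible p V 2 (two_star a b (insert d Z))"
    using assms Z by (auto intro!: reversible_two_star simp: card_insert_if)
  then have "reversible p V (2 + 2)
      (sym_diff (two_star a b (insert c Z)) (two_star a b (insert d Z)))"
    by (rule reversible_sym_diff)
  also have "sym_diff (two_star a b (insert c Z)) (two_star a b (insert d Z)) =
      two_star a b (sym_diff (insert c Z) (insert d Z))"
    using assms Z by (intro two_star_sym_diff) auto
  also have "sym_diff (insert c Z) (insert d Z) = {c, d}"
    using assms Z by auto
  finally show ?thesis by simp
qed

text \<open>Split \<open>S\<close> into pairs arbitrarily; each pair contributes one four-cycle
  through \<open>a\<close> and \<open>b\<close>.\<close>

lemma reversible_two_star_even:
  assumes "finite V" and "p + 2 \<le> card V" and "2 \<le> p" and "a \<in> V" "b \<in> V" "a \<noteq> b"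
    and "S \<subseteq> V - {a, b}" and "card S = 2 * m"
  shows "reversible p V (4 * m) (two_star a b S)"
  using assms(7,8)
proof (induction m arbitrary: S)
  case 0
  then have "finite S" using assms(1) by (auto intro: finite_subset)
  then have "S = {}" using 0 by simp
  then show ?case by (simp add: two_star_def reversible_empty)
next
  case (Suc m)
  have "finite S" using Suc.prems(1) assms(1) by (auto intro: finite_subset)
  have "2 \<le> card S" using Suc.prems(2) by simp
  then obtain T where T: "T \<subseteq> S" "card T = 2"
    by (rule obtain_subset_with_card_n)
  then obtain c d where cd: "T = {c, d}" "c \<noteq> d"
    by (auto simp: card_2_iff)
  have "card (S - T) = 2 * m"
    using T Suc.prems \<open>finite S\<close> by (simp add: card_Diff_subset finite_subset)
  then have "reversible p V (4 * m) (two_star a b (S - T))"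
    using Suc.prems(1) by (intro Suc.IH) auto
  moreover have "reversible p V 4 (two_star a b T)"
    unfolding cd using assms cd T Suc.prems by (intro reversible_four_cycle) auto
  ultimately have "reversible p V (4 * m + 4) (sym_diff (two_star a b (S - T)) (two_star a b T))"
    by (rule reversible_sym_diff)
  also have "sym_diff (two_star a b (S - T)) (two_star a b T) =
      two_star a b (sym_diff (S - T) T)"
    using Suc.prems T by (intro two_star_sym_diff) auto
  also have "sym_diff (S - T) T = S" using T by auto
  finally show ?case by (simp add: add.commute)
qed

lemma reversible_path:
  assumes "finite V" and "p + 2 \<le> card V" and "2 \<le> p" and "even p" and "{a, b, c} \<subseteq> V"
    and "distinct [a, b, c]"
  shows "reversible p V (2 * p - 2) {{a, c}, {b, c}}"
proof -
  have "card (V - {a, b, c}) = card V - 3"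
    using assms by (subst card_Diff_subset) auto
  then have "p - 2 \<le> card (V - {a, b, c})"
    using assms by simp
  then obtain S where S: "S \<subseteq> V - {a, b, c}" "card S = p - 2" "finite S"
    by (meson obtain_subset_with_card_n)
  have "even (p - 2)" using assms(4) by simp
  then obtain m where m: "p - 2 = 2 * m" by (rule evenE)
  have "reversible p V 2 (two_star a b (insert c S))"
    using assms S by (auto intro!: reversible_two_star simp: card_insert_if)
  moreover have "reversible p V (4 * m) (two_star a b S)"
    using assms S m by (intro reversible_two_star_even) auto
  ultimately have "reversible p V (2 + 4 * m)
      (sym_diff (two_star a b (insert c S)) (two_star a b S))"
    by (rule reversible_sym_diff)
  also have "sym_diff (two_star a b (insert c S)) (two_star a b S) =
      two_star a b (sym_diff (insert c S) S)"
    using S assms by (intro two_star_sym_diff) auto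
  also have "sym_diff (insert c S) S = {c}" using S by auto
  also have "two_star a b {c} = {{a, c}, {b, c}}" by (auto simp: two_star_def)
  also have "2 + 4 * m = 2 * p - 2" using m assms(3) by linarith
  finally show ?thesis .
qed

section \<open>Pairs of edges and even edge sets\<close>

lemma reversible_edge_pair:
  assumes "finite V" and "p + 2 \<le> card V" and "2 \<le> p" and "even p"
    and "e \<subseteq> V" "card e = 2" and "f \<subseteq> V" "card f = 2" and "e \<noteq> f"
  shows "reversible p V ((2 * p - 2) * 2) {e, f}"
proof (cases "e \<inter> f = {}")
  case False
  then obtain c where "c \<in> e" "c \<in> f" by auto
  moreover obtain a where "e = {a, c}" "a \<noteq> c"
    using assms(6) \<open>c \<in> e\<close> by (auto simp: card_2_iff)
  moreover obtain b where "f = {b, c}" "b \<noteq> c"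
    using assms(8) \<open>c \<in> f\<close> by (auto simp: card_2_iff)
  ultimately have "reversible p V (2 * p - 2) {e, f}"
    using assms by (auto intro!: reversible_path)
  then show ?thesis by (rule reversible_mono) simp
next
  case True
  obtain a b c d where e: "e = {a, b}" "a \<noteq> b" and f: "f = {c, d}" "c \<noteq> d"
    using assms(6,8) by (auto simp: card_2_iff)
  \<comment> \<open>The auxiliary edge between \<open>b\<close> and \<open>c\<close> lies on both
    paths and is reversed twice, so it cancels.\<close>
  have "reversible p V (2 * p - 2) {{a, b}, {c, b}}" "reversible p V (2 * p - 2) {{b, c}, {d, c}}"
    using assms e f True by (auto intro!: reversible_path)
  then have "reversible p V (2 * p - 2 + (2 * p - 2))
      (sym_diff {{a, b}, {c, b}} {{b, c}, {d, c}})"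
    by (rule reversible_sym_diff)
  also have "sym_diff {{a, b}, {c, b}} {{b, c}, {d, c}} = {e, f}"
    using e f True by (auto simp: doubleton_eq_iff)
  finally show ?thesis by (simp add: mult_2_right)
qed

lemma reversible_even_edge_set:
  assumes "finite V" and "p + 2 \<le> card V" and "2 \<le> p" and "even p"
    and "\<forall>e \<in> E. e \<subseteq> V \<and> card e = 2" and "card E = 2 * m"
  shows "reversible p V ((2 * p - 2) * card E) E"
  using assms(5,6)
proof (induction m arbitrary: E)
  case 0
  have "E \<subseteq> Pow V" using 0 by auto
  then have "finite E" using assms(1) by (simp add: finite_subset)
  then have "E = {}" using 0 by simp
  then show ?case by (simp add: reversible_empty)
next
  case (Suc m)
  have "E \<subseteq> Pow V" using Suc.prems by auto
  then have "finite E" using assms(1) by (simp add: finite_subset)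
  have "2 \<le> card E" using Suc.prems(2) by simp
  then obtain T where T: "T \<subseteq> E" "card T = 2"
    by (rule obtain_subset_with_card_n)
  then obtain e f where ef: "T = {e, f}" "e \<noteq> f"
    by (auto simp: card_2_iff)
  have card: "card (E - T) = 2 * m"
    using T Suc.prems \<open>finite E\<close> by (simp add: card_Diff_subset finite_subset)
  then have "reversible p V ((2 * p - 2) * card (E - T)) (E - T)"
    using Suc.prems(1) by (intro Suc.IH) auto
  moreover have "reversible p V ((2 * p - 2) * 2) T"
    unfolding ef(1) using assms ef T Suc.prems by (intro reversible_edge_pair) auto
  ultimately have "reversible p V ((2 * p - 2) * card (E - T) + (2 * p - 2) * 2)
      (sym_diff (E - T) T)"
    by (rule reversible_sym_diff)
  also have "sym_diff (E - T) T = E" using T by auto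
  also have "(2 * p - 2) * card (E - T) + (2 * p - 2) * 2 = (2 * p - 2) * card E"
    using card Suc.prems(2) by (simp flip: add_mult_distrib2)
  finally show ?case .
qed

section \<open>Acyclicity and vertex orderings\<close>

text \<open>A cycle is a nonempty closed walk, and conversely every nonempty closed walk yields a
  cycle; such walks witness \<open>(u, u)\<close> in the transitive closure.\<close>

lemma acyclic_digraph_iff:
  assumes "pair_wf_digraph D"
  shows "acyclic_digraph D \<longleftrightarrow> acyclic (parcs D)"
proof -
  interpret pair_wf_digraph D by fact
  have "(\<exists>c. cycle c) \<longleftrightarrow> (\<exists>u. (u, u) \<in> (parcs D)\<^sup>+)"
    using closed_w_imp_cycle unfolding reachable1_awalk closed_w_def cycle_def by blast
  then show ?thesis
    by (auto simp: acyclic_digraph_def acyclic_def)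
qed

lemma acyclic_if_increasing:
  fixes g :: "'a \<Rightarrow> nat"
  assumes "\<And>u v. (u, v) \<in> R \<Longrightarrow> g u < g v"
  shows "acyclic R"
proof (rule acyclicI, intro allI notI)
  have "g u < g v" if "(u, v) \<in> R\<^sup>+" for u v
    using that by induction (auto dest: assms)
  then show False if "(u, u) \<in> R\<^sup>+" for u
    using that by blast
qed

text \<open>The number \<open>P v\<close> of strict predecessors grows along arcs, but ties are
  possible. Scaling it by \<open>N\<close> and adding an injective \<open>h v < N\<close> breaks
  them: \<open>h\<close> is recovered modulo \<open>N\<close>.\<close>

lemma acyclic_imp_inj_increasing:
  assumes "finite V" and "R \<subseteq> V \<times> V" and "acyclic R"
  shows "\<exists>g :: 'a \<Rightarrow> nat. inj_on g V \<and> (\<forall>(u, v) \<in> R. g u < g v)"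
proof -
  obtain h :: "'a \<Rightarrow> nat" and N where h: "h ` V = {i. i < N}" "inj_on h V"
    using finite_imp_inj_to_nat_seg[OF assms(1)] by auto
  define P where "P v = card {u. (u, v) \<in> R\<^sup>+}" for v
  define g where "g v = P v * N + h v" for v
  have hN: "h v < N" if "v \<in> V" for v using h that by auto
  have "R\<^sup>+ \<subseteq> V \<times> V" using assms(2) by (rule trancl_subset_Sigma)
  have "P u < P v" if "(u, v) \<in> R" for u v
    unfolding P_def
  proof (rule psubset_card_mono)
    show "finite {u. (u, v) \<in> R\<^sup>+}"
      by (rule finite_subset[OF _ assms(1)]) (use \<open>R\<^sup>+ \<subseteq> V \<times> V\<close> in auto)
    \<comment> \<open>Strictness is witnessed by \<open>u\<close>, which precedes \<open>v\<close>
      but, by acyclicity, not itself.\<close>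
    show "{w. (w, u) \<in> R\<^sup>+} \<subset> {w. (w, v) \<in> R\<^sup>+}"
      using that assms(3) by (auto simp: acyclic_def)
  qed
  then have "g u < g v" if "(u, v) \<in> R" for u v
  proof -
    have "g u < Suc (P u) * N" using hN that assms(2) by (auto simp: g_def)
    also have "\<dots> \<le> P v * N" using \<open>(u, v) \<in> R \<Longrightarrow> P u < P v\<close> that by (intro mult_right_mono) auto
    finally show ?thesis by (simp add: g_def)
  qed
  moreover have "inj_on g V"
  proof (rule inj_onI)
    fix u v assume *: "u \<in> V" "v \<in> V" "g u = g v"
    have "g w mod N = h w" if "w \<in> V" for w using hN[OF that] by (simp add: g_def)
    then have "h u = h v" using * by metis
    then show "u = v" using * h(2) by (simp add: inj_onD)
  qed
  ultimately show ?thesis by blast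
qed

section \<open>Vertex orderings with few backward arcs\<close>

definition backward :: "('a \<Rightarrow> nat) \<Rightarrow> ('a \<times> 'a) set \<Rightarrow> ('a \<times> 'a) set" where
  "backward g R = {(u, v) \<in> R. g v < g u}"

lemma fas_ordering:
  assumes "oriented_graph D"
  shows "\<exists>g. inj_on g (pverts D) \<and> card (backward g (parcs D)) \<le> fas D"
proof -
  interpret oriented_graph D by fact
  let ?K = "{card F | F. F \<subseteq> parcs D \<and> acyclic_digraph (delete_arcs F D)}"
  have wf: "pair_wf_digraph (delete_arcs F D)" for F
    by unfold_locales (auto simp: delete_arcs_def dest: wellformed')
  \<comment> \<open>The infimum over \<open>nat\<close> is attained once the set is nonempty;
    deleting all arcs provides a member.\<close>
  have "acyclic_digraph (delete_arcs (parcs D) D)"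
    unfolding acyclic_digraph_iff[OF wf] by (simp add: delete_arcs_def acyclic_def)
  then have "?K \<noteq> {}" by blast
  then have "fas D \<in> ?K" unfolding fas_def by (rule Inf_nat_def1)
  then obtain F where F: "F \<subseteq> parcs D" "acyclic_digraph (delete_arcs F D)" "fas D = card F"
    by auto
  have "acyclic (parcs D - F)"
    using F(2) unfolding acyclic_digraph_iff[OF wf] by (simp add: delete_arcs_def)
  moreover have "parcs D - F \<subseteq> pverts D \<times> pverts D"
    by (auto dest: wellformed')
  ultimately obtain g :: "'a \<Rightarrow> nat" where g: "inj_on g (pverts D)" "\<forall>(u, v) \<in> parcs D - F. g u < g v"
    using acyclic_imp_inj_increasing[OF pair_finite_verts] by blast
  have "backward g (parcs D) \<subseteq> F"
    using g(2) by (auto simp: backward_def dest: less_asym)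
  then have "card (backward g (parcs D)) \<le> fas D"
    using F pair_finite_arcs by (metis card_mono finite_subset)
  then show ?thesis using g(1) by blast
qed

lemma ordering_toggle_arc:
  assumes "oriented_graph D" and inj: "inj_on g (pverts D)" and "parcs D \<noteq> {}"
  shows "\<exists>g'. inj_on g' (pverts D) \<and>
    (\<exists>a \<in> parcs D. backward g' (parcs D) = sym_diff (backward g (parcs D)) {a})"
proof -
  interpret oriented_graph D by fact
  define adj where "adj x y \<longleftrightarrow> (x, y) \<in> parcs D \<or> (y, x) \<in> parcs D" for x y
  have adj: "adj x y \<Longrightarrow> x \<in> pverts D \<and> y \<in> pverts D \<and> g x \<noteq> g y" for x y
    using inj pair_no_loops[of "(x, y)"] pair_no_loops[of "(y, x)"]
    by (auto simp: adj_def inj_on_def dest: wellformed')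
  define Q where "Q = (\<lambda>(x, y). adj x y \<and> g x < g y)"
  obtain a b where "(a, b) \<in> parcs D" using assms(3) by auto
  then have "Q (a, b) \<or> Q (b, a)"
    using adj[of a b] by (auto simp: Q_def adj_def)
  then obtain q where "Q q" by blast
  \<comment> \<open>\<open>Q\<close> lists each adjacent pair in increasing order of
    \<open>g\<close>, so the subtraction on \<open>nat\<close> is the true length. The direction of
    the arc is ignored.\<close>
  obtain x y where xy: "Q (x, y)" and min: "\<And>u v. Q (u, v) \<Longrightarrow> g y - g x \<le> g v - g u"
    using ex_has_least_nat[of Q q "\<lambda>(x, y). g y - g x", OF \<open>Q q\<close>] by (auto simp: split_paired_all)
  \<comment> \<open>Doubling frees the odd numbers, so \<open>x\<close> can be placed directly above
    \<open>y\<close> without a tie.\<close>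
  define g' where "g' v = (if v = x then 2 * g y + 1 else 2 * g v)" for v
  have "inj_on g' (pverts D)"
    using inj unfolding g'_def inj_on_def by (auto; presburger)
  obtain a where a: "a \<in> parcs D" "a \<in> {(x, y), (y, x)}"
    using xy by (auto simp: Q_def adj_def)
  have flip: "g' v < g' u \<longleftrightarrow> \<not> g v < g u" if "{u, v} = {x, y}" for u v
    using that xy by (auto simp: g'_def Q_def doubleton_eq_iff)
  \<comment> \<open>By minimality, no neighbour of \<open>x\<close> lies strictly between \<open>x\<close> and \<open>y\<close>.\<close>
  have keep: "g' v < g' u \<longleftrightarrow> g v < g u" if "adj u v" "{u, v} \<noteq> {x, y}" for u v
  proof -
    have far: "g y < g z \<or> g z < g x" if "adj x z" "z \<noteq> y" for z
    proof (cases "g x < g z")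
      case True
      then have "g y \<le> g z" using min[of x z] that xy by (auto simp: Q_def)
      moreover have "g y \<noteq> g z"
        using inj that adj[OF that(1)] adj[of x y] xy by (auto simp: Q_def inj_on_def)
      ultimately show ?thesis by simp
    next
      case False
      then show ?thesis using adj[OF that(1)] by auto
    qed
    have "adj v u" using that by (auto simp: adj_def)
    have "g x < g y" using xy by (simp add: Q_def)
    consider "u = x" | "v = x" | "u \<noteq> x" "v \<noteq> x" by blast
    then show ?thesis
    proof cases
      case 1
      then have "v \<noteq> x" "v \<noteq> y" using that adj[OF that(1)] by auto
      then show ?thesis using far[of v] 1 that \<open>g x < g y\<close> by (auto simp: g'_def)
    next
      case 2
      then have "u \<noteq> x" "u \<noteq> y" using that adj[OF that(1)] by auto
      then show ?thesis using far[of u] 2 \<open>adj v u\<close> \<open>g x < g y\<close> by (auto simp: g'_def)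
    qed (auto simp: g'_def)
  qed
  have "(u, v) \<in> backward g' (parcs D) \<longleftrightarrow> (u, v) \<in> sym_diff (backward g (parcs D)) {a}" for u v
  proof (cases "(u, v) \<in> parcs D")
    case True
    then have "adj u v" by (simp add: adj_def)
    \<comment> \<open>Without digons, \<open>a\<close> is the only arc between \<open>x\<close> and
      \<open>y\<close>, so exactly one arc is toggled.\<close>
    have "{u, v} = {x, y} \<longleftrightarrow> (u, v) = a"
      using a True no_digon by (auto simp: doubleton_eq_iff)
    then show ?thesis
      using flip[of u v] keep[OF \<open>adj u v\<close>] True by (auto simp: backward_def)
  next
    case False
    then show ?thesis using a(1) by (auto simp: backward_def)
  qed
  then have "backward g' (parcs D) = sym_diff (backward g (parcs D)) {a}"
    by (intro set_eqI) (metis surj_pair)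
  then show ?thesis using \<open>inj_on g' (pverts D)\<close> a(1) by blast
qed

lemma even_ordering:
  assumes "oriented_graph D"
  shows "\<exists>g. inj_on g (pverts D) \<and> even (card (backward g (parcs D))) \<and>
    card (backward g (parcs D)) \<le> fas D + 1"
proof -
  interpret oriented_graph D by fact
  obtain g where g: "inj_on g (pverts D)" "card (backward g (parcs D)) \<le> fas D"
    using fas_ordering[OF assms] by auto
  have fin: "finite (backward g (parcs D))"
    using pair_finite_arcs by (auto simp: backward_def intro: finite_subset)
  show ?thesis
  proof (cases "even (card (backward g (parcs D)))")
    case True
    then show ?thesis using g by (intro exI[of _ g]) simp
  next
    case False
    \<comment> \<open>An odd number of backward arcs is nonzero, so there is an arc to
      toggle.\<close>
    then have "parcs D \<noteq> {}" by (auto simp: backward_def)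
    then obtain g' a where g': "inj_on g' (pverts D)"
      "backward g' (parcs D) = sym_diff (backward g (parcs D)) {a}"
      using ordering_toggle_arc[OF assms g(1)] by blast
    show ?thesis
    \<comment> \<open>Toggling \<open>a\<close> changes the count by one and makes it even; the case
      of an added arc accounts for the summand 1 in the bound.\<close>
    proof (cases "a \<in> backward g (parcs D)")
      case True
      then have "backward g' (parcs D) = backward g (parcs D) - {a}" using g'(2) by auto
      then have "Suc (card (backward g' (parcs D))) = card (backward g (parcs D))"
        using True fin by (metis card_Suc_Diff1)
      then show ?thesis using g g'(1) False by (intro exI[of _ g']) (auto dest: sym)
    next
      case nin: False
      then have "backward g' (parcs D) = insert a (backward g (parcs D))" using g'(2) by auto
      then have "card (backward g' (parcs D)) = Suc (card (backward g (parcs D)))"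
        using nin fin by simp
      then show ?thesis using g g'(1) False by (intro exI[of _ g']) simp
    qed
  qed
qed

theorem theorem4p3:
  fixes p :: nat and D :: "'a pair_pre_digraph"
  assumes "p \<ge> 4" and "even p"
    and "oriented_graph D" and "card (pverts D) \<ge> p + 2"
  shows "inv_eq p D \<le> enat ((2 * p - 2) * (fas D + 1))"
proof -
  interpret oriented_graph D by fact
  obtain g where g: "inj_on g (pverts D)" "even (card (backward g (parcs D)))"
    "card (backward g (parcs D)) \<le> fas D + 1"
    using even_ordering[OF assms(3)] by auto
  define E where "E = (\<lambda>(u, v). {u, v}) ` backward g (parcs D)"
  \<comment> \<open>An arc and its reverse cannot both decrease \<open>g\<close>, so distinct
    backward arcs give distinct edges.\<close>
  have "inj_on (\<lambda>(u, v). {u, v}) (backward g (parcs D))"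
    by (auto simp: inj_on_def backward_def doubleton_eq_iff)
  then have card_E: "card E = card (backward g (parcs D))"
    unfolding E_def by (rule card_image)
  then obtain m where "card E = 2 * m" using g(2) by auto
  moreover have "\<forall>e \<in> E. e \<subseteq> pverts D \<and> card e = 2"
    by (auto simp: E_def backward_def card_2_iff dest: wellformed')
  ultimately have "reversible p (pverts D) ((2 * p - 2) * card E) E"
    using assms pair_finite_verts by (intro reversible_even_edge_set) auto
  then obtain Xs where Xs: "\<forall>X \<in> set Xs. X \<subseteq> pverts D \<and> card X = p"
    "length Xs \<le> (2 * p - 2) * card E"
    "\<And>e. card e = 2 \<Longrightarrow> e \<in> odd_pairs Xs \<longleftrightarrow> e \<in> E"
    unfolding reversible_def by blast
  \<comment> \<open>Exactly the backward arcs are reversed, so afterwards every arc increases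
    \<open>g\<close>.\<close>
  have increasing: "(u, v) \<in> parcs (fold inversion Xs D) \<Longrightarrow> g u < g v" for u v
  proof -
    assume "(u, v) \<in> parcs (fold inversion Xs D)"
    then obtain a b where ab: "(a, b) \<in> parcs D"
      "(u, v) = (if {a, b} \<in> odd_pairs Xs then (b, a) else (a, b))"
      unfolding parcs_fold_inversion by auto
    have "a \<noteq> b" using ab(1) pair_no_loops by fastforce
    then have "g a \<noteq> g b" using g(1) ab(1) by (auto simp: inj_on_def dest: wellformed')
    have "{a, b} \<in> odd_pairs Xs \<longleftrightarrow> {a, b} \<in> E" using Xs(3) \<open>a \<noteq> b\<close> by simp
    \<comment> \<open>Without digons, the edge can only come from the arc \<open>(a, b)\<close>
      itself.\<close>
    also have "\<dots> \<longleftrightarrow> (a, b) \<in> backward g (parcs D)"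
      using ab(1) no_digon by (auto simp: E_def backward_def doubleton_eq_iff)
    also have "\<dots> \<longleftrightarrow> g b < g a" using ab(1) by (simp add: backward_def)
    finally show "g u < g v" using ab(2) \<open>g a \<noteq> g b\<close> by (auto split: if_splits)
  qed
  have "pair_wf_digraph (fold inversion Xs D)"
    by unfold_locales (auto simp: parcs_fold_inversion dest: wellformed' split: if_splits)
  then have "acyclic_digraph (fold inversion Xs D)"
    using acyclic_if_increasing[OF increasing] by (simp add: acyclic_digraph_iff)
  then have "inv_eq p D \<le> enat (length Xs)"
    unfolding inv_eq_def using Xs(1) by (intro Inf_lower) blast
  also have "length Xs \<le> (2 * p - 2) * (fas D + 1)"
    using Xs(2) g(3) unfolding card_E by (meson le_trans mult_le_mono2)
  finally show ?thesis by simp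
qed

end
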